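(* The probability measure $\mu_{k+1}^i$ over the set $\Theta$ defined by the update protocol $$\mu_{k+1}^i(B)\ \propto\ \int_B p^i_\theta(x^i_{k+1})\prod_{j=1}^n\big(d\mu_k^j(\theta)\big)^{a_{ij}}\qquad\text{for measurable }B\subseteq\Theta$$ coincides, almost everywhere, with the update of the distributed stochastic mirror descent algorithm applied to the optimization problem $\min_{\theta\in\Theta}\sum_{i=1}^nD_{KL}(P^i\|P^i_\theta)$; that is, its density $d\mu_{k+1}^i$ coincides almost everywhere with $$\operatorname*{arg\,min}_{\pi\in\Delta_\Theta}\Big\{\big\langle-\log p^i_\theta(x^i_{k+1}),\pi\big\rangle+\sum_{j=1}^na_{ij}D_{KL}(\pi\|d\mu_k^j)\Big\}.$$
   Context: There are $n$ agents communicating over an undirected graph with edge set $E$. Agent $i$ observes samples $x^i_1,x^i_2,\dots$ from an unknown distribution $P^i$ and has a private family $\{P^i_\theta:\theta\in\Theta\}$ with densities $p^i_\theta$ with respect to a $\sigma$-finite measure, measurable in $\theta$. $\Theta$ is equipped with a $\sigma$-algebra and a reference measure $\kappa$; $\Delta_\Theta$ is the set of all probability densities on $\Theta$ (with respect to $\kappa$). The belief $\mu_k^j$ of agent $j$ at time $k$ is a probability measure on $\Theta$ dominated by $\kappa$, and $d\mu_k^j(\theta)$ denotes its density. All integrals over $\Theta$ are with respect to $\kappa$, and "$\propto$" means normalization to total mass $1$ over $\Theta$. $\langle f,\pi\rangle=\int_\Theta f(\theta)\pi(\theta)\,d\kappa(\theta)$; $D_{KL}(P\|Q)=-\mathbb{E}_P[\log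 dQ/dP]$ is the Kullback–Leibler divergence, so for densities $\pi,q$ on $\Theta$, $D_{KL}(\pi\|q)=\int_\Theta\pi\log(\pi/q)\,d\kappa$. The number $a_{ij}$ is the weight that agent $i$ assigns to the belief coming from agent $j$: $a_{ij}>0$ if $(i,j)\in E$ or $j=i$, and $a_{ij}=0$ if $j\ne i$ and $(i,j)\notin E$.
   Formalization: Two assumptions are added, without which the claim fails: the weights of each agent sum to one, and at the density of the updated belief the objective in braces is not of the undefined form minus infinity plus infinity. *)

theory Defs
  imports "HOL-Probability.Probability"
begin

definition prob_densities :: "'a measure \<Rightarrow> ('a \<Rightarrow> real) set" where
  "prob_densities M =
     {f \<in> borel_measurable M. (\<forall>x\<in>space M. 0 \<le> f x) \<and> (\<integral>\<^sup>+ x. ennreal (f x) \<partial>M) = 1}"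

text \<open>\<open>f\<close> is a version of the density of the probability measure \<open>N\<close> with respect to \<open>M\<close>.\<close>

definition prob_density_of :: "'a measure \<Rightarrow> 'a measure \<Rightarrow> ('a \<Rightarrow> real) \<Rightarrow> bool" where
  "prob_density_of M N f \<longleftrightarrow> f \<in> prob_densities M \<and> N = density M (\<lambda>x. ennreal (f x))"

text \<open>
  Logarithms and integrals are extended-real valued, since a Kullback--Leibler divergence may be
  infinite; \<open>KL_divergence\<close> from the library is a real number and takes a dummy value
  in that case.
\<close>

definition eln :: "ereal \<Rightarrow> ereal" where
  "eln x = (if x \<le> 0 then - \<infinity> else if x = \<infinity> then \<infinity> else ereal (ln (real_of_ereal x)))"

definition positive_part_integral :: "'a measure \<Rightarrow> ('a \<Rightarrow> ereal) \<Rightarrow> ennreal" where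
  "positive_part_integral M f = (\<integral>\<^sup>+ x. e2ennreal (max 0 (f x)) \<partial>M)"

definition ext_integral_exists :: "'a measure \<Rightarrow> ('a \<Rightarrow> ereal) \<Rightarrow> bool" where
  "ext_integral_exists M f \<longleftrightarrow>
     positive_part_integral M f \<noteq> \<infinity> \<or> positive_part_integral M (\<lambda>x. - f x) \<noteq> \<infinity>"

text \<open>On \<open>ereal\<close> we have \<open>\<infinity> - \<infinity> = \<infinity>\<close>, which is the value here if the integral does not exist.\<close>

definition ext_integral :: "'a measure \<Rightarrow> ('a \<Rightarrow> ereal) \<Rightarrow> ereal" where
  "ext_integral M f =
     enn2ereal (positive_part_integral M f) - enn2ereal (positive_part_integral M (\<lambda>x. - f x))"

definition pairing :: "'a measure \<Rightarrow> ('a \<Rightarrow> ereal) \<Rightarrow> ('a \<Rightarrow> real) \<Rightarrow> ereal" where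
  "pairing \<kappa> f \<pi> = ext_integral \<kappa> (\<lambda>\<theta>. f \<theta> * ereal (\<pi> \<theta>))"

text \<open>
  The \<open>ereal\<close> conventions \<open>c / 0 = \<infinity>\<close> for \<open>c > 0\<close> and \<open>0 * (- \<infinity>) = 0\<close> give the integrand the
  usual values: \<open>\<infinity>\<close> where \<open>\<pi> > 0 = q\<close>, and \<open>0\<close> where \<open>\<pi> = 0\<close>.
\<close>

definition KL_densities :: "'a measure \<Rightarrow> ('a \<Rightarrow> real) \<Rightarrow> ('a \<Rightarrow> real) \<Rightarrow> ereal" where
  "KL_densities \<kappa> \<pi> q =
     ext_integral \<kappa> (\<lambda>\<theta>. ereal (\<pi> \<theta>) * eln (ereal (\<pi> \<theta>) / ereal (q \<theta>)))"

text \<open>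
  One step of distributed stochastic mirror descent for an agent with weights \<open>w\<close>, given the
  sampled loss \<open>f\<close> and the current densities \<open>q 1, \<dots>, q n\<close> of the agents. A summand of weight
  \<open>0\<close> vanishes even if its divergence is infinite.
\<close>

definition dsmd_regularizer ::
    "'a measure \<Rightarrow> nat \<Rightarrow> (nat \<Rightarrow> real) \<Rightarrow> (nat \<Rightarrow> 'a \<Rightarrow> real) \<Rightarrow> ('a \<Rightarrow> real) \<Rightarrow> ereal" where
  "dsmd_regularizer \<kappa> n w q \<pi> = (\<Sum>j\<in>{1..n}. ereal (w j) * KL_densities \<kappa> \<pi> (q j))"

definition dsmd_objective ::
    "'a measure \<Rightarrow> nat \<Rightarrow> (nat \<Rightarrow> real) \<Rightarrow> ('a \<Rightarrow> ereal) \<Rightarrow> (nat \<Rightarrow> 'a \<Rightarrow> real) \<Rightarrow> ('a \<Rightarrow> real) \<Rightarrow> ereal"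
  where "dsmd_objective \<kappa> n w f q \<pi> = pairing \<kappa> f \<pi> + dsmd_regularizer \<kappa> n w q \<pi>"

text \<open>
  The objective makes sense at \<open>\<pi>\<close> unless its value is of the form \<open>\<infinity> - \<infinity>\<close>. Where it does not,
  \<open>dsmd_objective\<close> is \<open>\<infinity>\<close>, so that such a \<open>\<pi>\<close> is excluded from the minimization.
\<close>

definition dsmd_objective_exists ::
    "'a measure \<Rightarrow> nat \<Rightarrow> (nat \<Rightarrow> real) \<Rightarrow> ('a \<Rightarrow> ereal) \<Rightarrow> (nat \<Rightarrow> 'a \<Rightarrow> real) \<Rightarrow> ('a \<Rightarrow> real) \<Rightarrow> bool"
  where
  "dsmd_objective_exists \<kappa> n w f q \<pi> \<longleftrightarrow>
     ext_integral_exists \<kappa> (\<lambda>\<theta>. f \<theta> * ereal (\<pi> \<theta>)) \<and>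
     \<not> (pairing \<kappa> f \<pi> = - \<infinity> \<and> dsmd_regularizer \<kappa> n w q \<pi> = \<infinity>)"

definition is_dsmd_update ::
    "'a measure \<Rightarrow> nat \<Rightarrow> (nat \<Rightarrow> real) \<Rightarrow> ('a \<Rightarrow> ereal) \<Rightarrow> (nat \<Rightarrow> 'a \<Rightarrow> real) \<Rightarrow> ('a \<Rightarrow> real) \<Rightarrow> bool"
  where
  "is_dsmd_update \<kappa> n w f q \<pi> \<longleftrightarrow>
     is_arg_min (dsmd_objective \<kappa> n w f q) (\<lambda>\<sigma>. \<sigma> \<in> prob_densities \<kappa>) \<pi>"

text \<open>
  The loss sampled at an observation \<open>y\<close>. Since \<open>D(P \<parallel> P\<^sub>\<theta>) = E\<^sub>P[- ln p\<^sub>\<theta>] + const\<close>, this is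
  the stochastic loss of the problem of minimizing the sum of the divergences \<open>D(P\<^sub>i \<parallel> P\<^sub>i\<^sub>,\<^sub>\<theta>)\<close>.
\<close>

definition neg_log_likelihood :: "('a \<Rightarrow> 'x \<Rightarrow> real) \<Rightarrow> 'x \<Rightarrow> 'a \<Rightarrow> ereal" where
  "neg_log_likelihood p y \<theta> = - eln (ereal (p \<theta> y))"

text \<open>
  Power with \<open>0\<close> to the \<open>0\<close> equal to \<open>1\<close>, in contrast to \<open>0 powr 0 = 0\<close>: the beliefs of
  agents of weight \<open>0\<close> must not enter the product below.
\<close>

definition weight_power :: "real \<Rightarrow> real \<Rightarrow> real" where
  "weight_power x w = (if w = 0 then 1 else x powr w)"

definition pooled_posterior ::
    "nat \<Rightarrow> (nat \<Rightarrow> real) \<Rightarrow> ('a \<Rightarrow> 'x \<Rightarrow> real) \<Rightarrow> 'x \<Rightarrow> (nat \<Rightarrow> 'a \<Rightarrow> real) \<Rightarrow> 'a \<Rightarrow> real" where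
  "pooled_posterior n w p y q \<theta> = p \<theta> y * (\<Prod>j\<in>{1..n}. weight_power (q j \<theta>) (w j))"

text \<open>\<open>N(B) \<propto> \<integral>\<^sub>B g d\<kappa>\<close>; the normalization presupposes that the total mass is neither \<open>0\<close> nor \<open>\<infinity>\<close>.\<close>

definition proportional_to :: "'a measure \<Rightarrow> 'a measure \<Rightarrow> ('a \<Rightarrow> real) \<Rightarrow> bool" where
  "proportional_to \<kappa> N g \<longleftrightarrow>
     (let Z = (\<integral>\<^sup>+ \<theta>. ennreal (g \<theta>) \<partial>\<kappa>) in
        sets N = sets \<kappa> \<and> Z \<noteq> 0 \<and> Z \<noteq> \<infinity> \<and>
        (\<forall>B\<in>sets \<kappa>. emeasure N B = (\<integral>\<^sup>+ \<theta>\<in>B. ennreal (g \<theta>) \<partial>\<kappa>) / Z))"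

text \<open>
  Agents are \<open>1, \<dots>, n\<close> with weights \<open>a i j\<close>; parameters range over \<open>space \<kappa>\<close>. Observations of
  agent \<open>i\<close> have the unknown distribution \<open>P i\<close>, and the model \<open>P\<^sub>\<theta> i \<theta>\<close> has
  the density \<open>p i \<theta>\<close> with respect to \<open>L i\<close>.
\<close>

locale cooperative_inference =
  fixes n :: nat
    and E :: "(nat \<times> nat) set"
    and a :: "nat \<Rightarrow> nat \<Rightarrow> real"
    and \<kappa> :: "'t measure"
    and L :: "nat \<Rightarrow> 'x measure"
    and P :: "nat \<Rightarrow> 'x measure"
    and P\<^sub>\<theta> :: "nat \<Rightarrow> 't \<Rightarrow> 'x measure"
    and p :: "nat \<Rightarrow> 't \<Rightarrow> 'x \<Rightarrow> real"
  assumes edges: "E \<subseteq> {1..n} \<times> {1..n}"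
    and undirected: "sym E"
    and weight_pos: "\<And>i j. \<lbrakk>i \<in> {1..n}; j \<in> {1..n}; (i, j) \<in> E \<or> j = i\<rbrakk> \<Longrightarrow> a i j > 0"
    and weight_zero: "\<And>i j. \<lbrakk>i \<in> {1..n}; j \<in> {1..n}; j \<noteq> i; (i, j) \<notin> E\<rbrakk> \<Longrightarrow> a i j = 0"
    and weight_sum: "\<And>i. i \<in> {1..n} \<Longrightarrow> (\<Sum>j\<in>{1..n}. a i j) = 1"
    and reference_measure: "\<And>i. i \<in> {1..n} \<Longrightarrow> sigma_finite_measure (L i)"
    and unknown_distribution: "\<And>i. i \<in> {1..n} \<Longrightarrow> prob_space (P i) \<and> sets (P i) = sets (L i)"
    and model_density:
      "\<And>i \<theta>. \<lbrakk>i \<in> {1..n}; \<theta> \<in> space \<kappa>\<rbrakk> \<Longrightarrow> prob_density_of (L i) (P\<^sub>\<theta> i \<theta>) (p i \<theta>)"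
    and measurable_parameter:
      "\<And>i y. \<lbrakk>i \<in> {1..n}; y \<in> space (L i)\<rbrakk> \<Longrightarrow> (\<lambda>\<theta>. p i \<theta> y) \<in> borel_measurable \<kappa>"

end

theory Submission
  imports Defs
begin

text \<open>Where \<open>\<sigma> > 0\<close>, the integrands of the loss and of the weighted divergences add up to
  \<open>\<sigma> ln (\<sigma> / \<pi>) - \<sigma> ln Z\<close>, where \<open>\<pi>\<close> is the normalized posterior and \<open>Z\<close> its normalization
  constant. Hence the objective at \<open>\<sigma>\<close> is \<open>D(\<sigma> \<parallel> \<pi>) - ln Z\<close> whenever it is finite, and
  Gibbs' inequality with its equality case shows that \<open>\<pi>\<close> is the only minimizer. The pointwise bound
  \<open>s ln (s / t) \<ge> s - t\<close> provides integrable minorants, which exclude \<open>\<infinity> - \<infinity>\<close> in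
  splitting the integrals.\<close>

section \<open>Integrals of extended-real functions and their real representatives\<close>

lemma borel_measurable_eln [measurable]: "eln \<in> borel_measurable borel"
  unfolding eln_def [abs_def] by measurable

lemma e2ennreal_max_ereal: "e2ennreal (max 0 (ereal r)) = ennreal r"
  by (simp add: ennreal_def)

lemma ext_integral_ereal:
  assumes h: "integrable M h" and eq: "AE x in M. f x = ereal (h x)"
  shows "ext_integral M f = ereal (integral\<^sup>L M h)"
proof -
  have p: "positive_part_integral M f = (\<integral>\<^sup>+ x. ennreal (h x) \<partial>M)"
    unfolding positive_part_integral_def
    by (rule nn_integral_cong_AE) (use eq in eventually_elim, simp add: e2ennreal_max_ereal)
  have m: "positive_part_integral M (\<lambda>x. - f x) = (\<integral>\<^sup>+ x. ennreal (- h x) \<partial>M)"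
    unfolding positive_part_integral_def
    by (rule nn_integral_cong_AE) (use eq in eventually_elim, simp add: e2ennreal_max_ereal)
  obtain r where r: "0 \<le> r" "(\<integral>\<^sup>+ x. ennreal (h x) \<partial>M) = ennreal r"
    using h unfolding real_integrable_def by (metis ennreal_cases infinity_ennreal_def)
  obtain s where s: "0 \<le> s" "(\<integral>\<^sup>+ x. ennreal (- h x) \<partial>M) = ennreal s"
    using h unfolding real_integrable_def by (metis ennreal_cases infinity_ennreal_def)
  show ?thesis
    unfolding ext_integral_def p m real_lebesgue_integral_def[OF h]
    by (simp add: r s enn2ereal_ennreal)
qed

lemma positive_part_integral_finite_AE:
  assumes [measurable]: "f \<in> borel_measurable M" and "positive_part_integral M f \<noteq> \<infinity>"
  shows "AE x in M. f x \<noteq> \<infinity>"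
proof -
  have "AE x in M. e2ennreal (max 0 (f x)) \<noteq> \<infinity>"
    by (rule nn_integral_PInf_AE)
       (use assms(2) in \<open>auto simp: positive_part_integral_def\<close>)
  then show ?thesis
    by eventually_elim (auto simp: max_def)
qed

text \<open>A difference of two \<open>ennreal\<close> values taken in \<open>ereal\<close> is
  finite only if both are finite, so \<open>f\<close> is finite almost everywhere and
  \<open>real_of_ereal\<close> of it is an integrable representative.\<close>

lemma ext_integral_finiteE:
  assumes f [measurable]: "f \<in> borel_measurable M" and fin: "\<bar>ext_integral M f\<bar> \<noteq> \<infinity>"
  obtains h where "integrable M h" "AE x in M. f x = ereal (h x)"
proof
  have p: "positive_part_integral M f \<noteq> \<infinity>" and m: "positive_part_integral M (\<lambda>x. - f x) \<noteq> \<infinity>"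
    using fin unfolding ext_integral_def
    by (cases "positive_part_integral M f"; cases "positive_part_integral M (\<lambda>x. - f x)"; simp)+
  show eq: "AE x in M. f x = ereal (real_of_ereal (f x))"
    using positive_part_integral_finite_AE[OF f p]
      positive_part_integral_finite_AE[OF borel_measurable_uminus_ereal[OF f] m]
  proof eventually_elim
    case (elim x)
    then show ?case by (cases "f x") auto
  qed
  have "(\<integral>\<^sup>+ x. ennreal (real_of_ereal (f x)) \<partial>M) = positive_part_integral M f"
    unfolding positive_part_integral_def
    by (rule nn_integral_cong_AE)
       (use eq in eventually_elim, metis e2ennreal_max_ereal)
  moreover have "(\<integral>\<^sup>+ x. ennreal (- real_of_ereal (f x)) \<partial>M) = positive_part_integral M (\<lambda>x. - f x)"
    unfolding positive_part_integral_def
    by (rule nn_integral_cong_AE)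
       (use eq in eventually_elim, metis e2ennreal_max_ereal uminus_ereal.simps(1))
  ultimately show "integrable M (\<lambda>x. real_of_ereal (f x))"
    unfolding real_integrable_def using p m by simp
qed

lemma positive_part_integral_bounded:
  assumes g: "integrable M g" and le: "AE x in M. f x \<le> ereal (g x)"
  shows "positive_part_integral M f \<noteq> \<infinity>"
proof -
  have "positive_part_integral M f \<le> (\<integral>\<^sup>+ x. ennreal (g x) \<partial>M)"
    unfolding positive_part_integral_def
    by (rule nn_integral_mono_AE)
       (use le in eventually_elim,
         metis e2ennreal_max_ereal e2ennreal_mono max.mono order_refl)
  then show ?thesis
    using g unfolding real_integrable_def by (auto simp: top_unique)
qed

text \<open>The integrable minorant makes the negative part finite. The value is then either
  \<infinity>, where the bound is trivial, or finite, where \<open>f\<close> has an integrable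
  representative and ordinary monotonicity applies.\<close>

lemma ext_integral_ge:
  assumes f: "f \<in> borel_measurable M"
    and g: "integrable M g" and le: "AE x in M. ereal (g x) \<le> f x"
  shows "ereal (integral\<^sup>L M g) \<le> ext_integral M f"
proof (cases "ext_integral M f = \<infinity>")
  case False
  have "positive_part_integral M (\<lambda>x. - f x) \<noteq> \<infinity>"
    by (rule positive_part_integral_bounded[of M "\<lambda>x. - g x"])
       (use g le in \<open>auto elim!: eventually_mono simp flip: uminus_ereal.simps(1)\<close>)
  then have "ext_integral M f \<noteq> - \<infinity>"
    unfolding ext_integral_def
    by (cases "positive_part_integral M f"; cases "positive_part_integral M (\<lambda>x. - f x)"; simp)
  then obtain h where h: "integrable M h" "AE x in M. f x = ereal (h x)"
    using ext_integral_finiteE[OF f] False by auto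
  have "AE x in M. g x \<le> h x"
    using le h(2) by eventually_elim simp
  then show ?thesis
    using integral_mono_AE[OF g h(1)] ext_integral_ereal[OF h] by simp
qed simp

lemma ext_integral_bounded_above:
  assumes "integrable M g" and "AE x in M. f x \<le> ereal (g x)"
  shows "ext_integral M f \<noteq> \<infinity>"
  using positive_part_integral_bounded[OF assms] unfolding ext_integral_def
  by (simp add: ereal_minus_eq_PInfty_iff)

section \<open>Probability densities\<close>

lemma prob_densitiesD:
  assumes "f \<in> prob_densities M"
  shows "f \<in> borel_measurable M" "\<And>x. x \<in> space M \<Longrightarrow> 0 \<le> f x"
    and "integrable M f" "integral\<^sup>L M f = 1"
proof -
  show m: "f \<in> borel_measurable M" and nn: "\<And>x. x \<in> space M \<Longrightarrow> 0 \<le> f x"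
    using assms by (auto simp: prob_densities_def)
  have i: "(\<integral>\<^sup>+ x. ennreal (f x) \<partial>M) = ennreal 1"
    using assms by (auto simp: prob_densities_def)
  then show "integrable M f" "integral\<^sup>L M f = 1"
    using nn_integral_eq_integrable[OF m, of 1] nn by auto
qed

lemma prob_space_prob_density_of:
  assumes "prob_density_of M N f"
  shows "prob_space N"
proof
  show "emeasure N (space N) = 1"
    using assms by (auto simp: prob_density_of_def prob_densities_def emeasure_density
        cong: nn_integral_cong)
qed

section \<open>Pointwise Gibbs inequality and the integrands of the objective\<close>

text \<open>This is \<open>ln u \<le> u - 1\<close> at \<open>u = t / s\<close>, multiplied by
  \<open>s\<close>; equality there forces \<open>u = 1\<close>. For \<open>s = 0\<close> the
  logarithmic term vanishes. The point \<open>t = 0 < s\<close>, where the true integrand is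
  \<infinity>, is excluded by the third premise.\<close>

lemma gibbs_pointwise:
  fixes s t :: real
  assumes "0 \<le> s" "0 \<le> t" "0 < s \<Longrightarrow> 0 < t"
  shows "s - t \<le> s * ln (s / t)" and "s * ln (s / t) = s - t \<Longrightarrow> s = t"
proof -
  have *: "s * ln (s / t) = - (s * ln (t / s))" "s * (t / s - 1) = t - s" if "0 < s"
    using that assms(3) by (auto simp: ln_div algebra_simps)
  show "s - t \<le> s * ln (s / t)"
  proof (cases "s = 0")
    case False
    then have s: "0 < s" using assms by simp
    then have "s * ln (t / s) \<le> s * (t / s - 1)"
      using assms(3) by (intro mult_left_mono ln_le_minus_one) auto
    then show ?thesis using *[OF s] by simp
  qed (use assms in auto)
  show "s = t" if eq: "s * ln (s / t) = s - t"
  proof (cases "s = 0")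
    case False
    then have s: "0 < s" using assms by simp
    then have "s * ln (t / s) = s * (t / s - 1)"
      using *[OF s] eq by simp
    then have "t / s = 1"
      using s assms(3) by (intro ln_eq_minus_one) auto
    then show ?thesis using s by simp
  qed (use eq in auto)
qed

lemma KL_integrand_eq:
  assumes "0 \<le> s" "0 \<le> t"
  shows "ereal s * eln (ereal s / ereal t)
    = (if 0 < s \<and> t = 0 then \<infinity> else ereal (s * ln (s / t)))"
proof -
  consider "s = 0" | "0 < s" "t = 0" | "0 < s" "0 < t"
    using assms by fastforce
  then show ?thesis
  proof cases
    case 2
    have "ereal s / ereal t = \<infinity>" using 2 by (simp add: divide_ereal_def zero_ereal_def[symmetric])
    then show ?thesis using 2 by (simp add: eln_def)
  qed (auto simp: eln_def divide_le_0_iff zero_ereal_def[symmetric])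
qed

lemma loss_integrand_eq:
  assumes "0 \<le> s" "0 \<le> p \<theta> y"
  shows "neg_log_likelihood p y \<theta> * ereal s
    = (if 0 < s \<and> p \<theta> y = 0 then \<infinity> else ereal (- (s * ln (p \<theta> y))))"
  using assms by (auto simp: neg_log_likelihood_def eln_def zero_ereal_def[symmetric])

text \<open>For weight 0 both sides are 0 whatever \<open>x\<close> is, so positivity is demanded
  only of beliefs that enter the product.\<close>

lemma ln_weight_power: "(w \<noteq> 0 \<Longrightarrow> 0 < x) \<Longrightarrow> ln (weight_power x w) = w * ln x"
  by (auto simp: weight_power_def ln_powr)

lemma weight_power_nonneg: "0 \<le> weight_power x w"
  by (auto simp: weight_power_def)

lemma weight_power_pos: "(w \<noteq> 0 \<Longrightarrow> 0 < x) \<Longrightarrow> 0 < weight_power x w"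
  by (auto simp: weight_power_def)

text \<open>Taking logarithms in \<open>Z * t = p * (product of powers)\<close> expresses
  \<open>ln Z + ln t\<close> by the logarithms of the factors, and the weights summing to 1 collapse
  the terms \<open>w j * (s * ln s)\<close> to a single \<open>s * ln s\<close>. Positivity is
  required only for \<open>0 < s\<close>, as both sides vanish at \<open>s = 0\<close>.\<close>

lemma entropy_decomposition:
  assumes Z: "0 < Z" and w: "(\<Sum>j\<in>{1..n}. w j) = 1" and s: "0 \<le> s"
    and pos: "0 < s \<Longrightarrow> 0 < p \<theta> y" "\<And>j. \<lbrakk>0 < s; j \<in> {1..n}; w j \<noteq> 0\<rbrakk> \<Longrightarrow> 0 < q j \<theta>"
    and g: "pooled_posterior n w p y q \<theta> = Z * t"
  shows "0 < s \<Longrightarrow> 0 < t"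
    and "- (s * ln (p \<theta> y)) + (\<Sum>j\<in>{1..n}. w j * (s * ln (s / q j \<theta>))) = s * ln (s / t) - s * ln Z"
proof -
  have prod: "0 < (\<Prod>j\<in>{1..n}. weight_power (q j \<theta>) (w j))" if "0 < s"
    using that pos by (intro prod_pos) (auto intro: weight_power_pos)
  show t: "0 < t" if "0 < s"
    using prod[OF that] pos(1)[OF that] g Z unfolding pooled_posterior_def
    by (metis mult_pos_pos zero_less_mult_pos)
  show "- (s * ln (p \<theta> y)) + (\<Sum>j\<in>{1..n}. w j * (s * ln (s / q j \<theta>))) = s * ln (s / t) - s * ln Z"
  proof (cases "s = 0")
    case False
    then have s0: "0 < s" using s by simp
    have "ln (\<Prod>j\<in>{1..n}. weight_power (q j \<theta>) (w j))
        = (\<Sum>j\<in>{1..n}. ln (weight_power (q j \<theta>) (w j)))"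
      by (intro ln_prod) (auto intro!: less_imp_neq[symmetric] weight_power_pos pos(2)[OF s0])
    also have "\<dots> = (\<Sum>j\<in>{1..n}. w j * ln (q j \<theta>))"
      using pos(2)[OF s0] by (intro sum.cong) (auto intro: ln_weight_power)
    finally have "ln (Z * t) = ln (p \<theta> y) + (\<Sum>j\<in>{1..n}. w j * ln (q j \<theta>))"
      unfolding g[symmetric] pooled_posterior_def
      using ln_mult_pos[OF pos(1)[OF s0] prod[OF s0]] by simp
    then have L: "ln Z + ln t = ln (p \<theta> y) + (\<Sum>j\<in>{1..n}. w j * ln (q j \<theta>))"
      using Z t[OF s0] by (simp add: ln_mult)
    have "(\<Sum>j\<in>{1..n}. w j * (s * ln (s / q j \<theta>)))
        = (\<Sum>j\<in>{1..n}. w j * (s * ln s) - s * (w j * ln (q j \<theta>)))"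
    proof (rule sum.cong)
      fix j assume "j \<in> {1..n}"
      then show "w j * (s * ln (s / q j \<theta>)) = w j * (s * ln s) - s * (w j * ln (q j \<theta>))"
        using pos(2)[OF s0, of j] s0 by (cases "w j = 0") (simp_all add: ln_div algebra_simps)
    qed simp
    also have "\<dots> = s * ln s - s * (\<Sum>j\<in>{1..n}. w j * ln (q j \<theta>))"
      using w by (simp add: sum_subtractf flip: sum_distrib_left sum_distrib_right)
    also have "\<dots> = s * ln s - s * (ln Z + ln t - ln (p \<theta> y))"
      using L by simp
    finally show ?thesis
      using s0 t[OF s0] by (simp add: ln_div algebra_simps)
  qed simp
qed

section \<open>Divergence between two densities\<close>

text \<open>The minorant \<open>\<sigma> - q\<close> of the integrand has integral
  \<open>1 - 1 = 0\<close>. An infinite divergence is covered as well.\<close>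

lemma KL_densities_nonneg:
  assumes s: "\<sigma> \<in> prob_densities M" and q: "q \<in> prob_densities M"
  shows "0 \<le> KL_densities M \<sigma> q"
proof -
  note [measurable] = prob_densitiesD(1)[OF s] prob_densitiesD(1)[OF q]
  have "ereal (\<integral>\<theta>. \<sigma> \<theta> - q \<theta> \<partial>M) \<le> KL_densities M \<sigma> q"
    unfolding KL_densities_def
  proof (rule ext_integral_ge)
    show "AE \<theta> in M. ereal (\<sigma> \<theta> - q \<theta>) \<le> ereal (\<sigma> \<theta>) * eln (ereal (\<sigma> \<theta>) / ereal (q \<theta>))"
    proof (rule AE_I2)
      fix \<theta> assume "\<theta> \<in> space M"
      note nn = prob_densitiesD(2)[OF s this] prob_densitiesD(2)[OF q this]
      show "ereal (\<sigma> \<theta> - q \<theta>) \<le> ereal (\<sigma> \<theta>) * eln (ereal (\<sigma> \<theta>) / ereal (q \<theta>))"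
        unfolding KL_integrand_eq[OF nn] using gibbs_pointwise(1)[OF nn] nn(2) by auto
    qed
  qed (use s q in \<open>auto dest: prob_densitiesD\<close>)
  then show ?thesis
    using s q by (simp add: prob_densitiesD zero_ereal_def)
qed

lemma KL_densities_eq_integral:
  assumes s: "\<sigma> \<in> prob_densities M" and q: "q \<in> prob_densities M"
    and int: "integrable M (\<lambda>\<theta>. \<sigma> \<theta> * ln (\<sigma> \<theta> / q \<theta>))"
    and pos: "AE \<theta> in M. 0 < \<sigma> \<theta> \<longrightarrow> 0 < q \<theta>"
  shows "KL_densities M \<sigma> q = ereal (\<integral>\<theta>. \<sigma> \<theta> * ln (\<sigma> \<theta> / q \<theta>) \<partial>M)"
  unfolding KL_densities_def
  by (rule ext_integral_ereal[OF int])
     (use pos AE_space in eventually_elim,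
       subst KL_integrand_eq[OF prob_densitiesD(2)[OF s] prob_densitiesD(2)[OF q]], auto)

text \<open>Nonnegativity rules out the value -\<infinity>, so the divergence is finite and its
  integrand is finite almost everywhere; that leaves no room for points with
  \<open>q \<theta> = 0 < \<sigma> \<theta>\<close> beyond a null set.\<close>

lemma KL_densities_finiteD:
  assumes s: "\<sigma> \<in> prob_densities M" and q: "q \<in> prob_densities M"
    and fin: "KL_densities M \<sigma> q \<noteq> \<infinity>"
  shows "integrable M (\<lambda>\<theta>. \<sigma> \<theta> * ln (\<sigma> \<theta> / q \<theta>))" and "AE \<theta> in M. 0 < \<sigma> \<theta> \<longrightarrow> 0 < q \<theta>"
proof -
  note [measurable] = prob_densitiesD(1)[OF s] prob_densitiesD(1)[OF q]
  have "(\<lambda>\<theta>. ereal (\<sigma> \<theta>) * eln (ereal (\<sigma> \<theta>) / ereal (q \<theta>))) \<in> borel_measurable M"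
    by measurable
  then obtain h where h: "integrable M h"
    and eq: "AE \<theta> in M. ereal (\<sigma> \<theta>) * eln (ereal (\<sigma> \<theta>) / ereal (q \<theta>)) = ereal (h \<theta>)"
    using KL_densities_nonneg[OF s q] fin ext_integral_finiteE unfolding KL_densities_def
    by (metis abs_ereal_ge0)
  have *: "AE \<theta> in M. (0 < \<sigma> \<theta> \<longrightarrow> 0 < q \<theta>) \<and> h \<theta> = \<sigma> \<theta> * ln (\<sigma> \<theta> / q \<theta>)"
    using eq AE_space
  proof eventually_elim
    case (elim \<theta>)
    note nn = prob_densitiesD(2)[OF s elim(2)] prob_densitiesD(2)[OF q elim(2)]
    show ?case
      using elim(1) nn(2) unfolding KL_integrand_eq[OF nn] by (auto split: if_splits)
  qed
  then show "AE \<theta> in M. 0 < \<sigma> \<theta> \<longrightarrow> 0 < q \<theta>" by auto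
  show "integrable M (\<lambda>\<theta>. \<sigma> \<theta> * ln (\<sigma> \<theta> / q \<theta>))"
    by (rule integrable_cong_AE_imp[OF h]) (use * in auto)
qed

section \<open>The objective at an arbitrary density\<close>

text \<open>The update of a single agent with weights \<open>w\<close> and observation
  \<open>y\<close>. The relation between \<open>\<pi>\<close> and the pooled posterior is imposed
  only almost everywhere, so that \<open>\<pi>\<close> can be any version of the updated
  density.\<close>

locale pooled_update =
  fixes \<kappa> :: "'t measure" and n :: nat and w :: "nat \<Rightarrow> real"
    and p :: "'t \<Rightarrow> 'x \<Rightarrow> real" and y :: 'x and q :: "nat \<Rightarrow> 't \<Rightarrow> real"
    and Z :: real and \<pi> :: "'t \<Rightarrow> real"
  assumes w_nonneg: "\<And>j. j \<in> {1..n} \<Longrightarrow> 0 \<le> w j"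
    and w_sum: "(\<Sum>j\<in>{1..n}. w j) = 1"
    and p_measurable [measurable]: "(\<lambda>\<theta>. p \<theta> y) \<in> borel_measurable \<kappa>"
    and p_nonneg: "\<And>\<theta>. \<theta> \<in> space \<kappa> \<Longrightarrow> 0 \<le> p \<theta> y"
    and q: "\<And>j. j \<in> {1..n} \<Longrightarrow> q j \<in> prob_densities \<kappa>"
    and Z_pos: "0 < Z"
    and \<pi>: "\<pi> \<in> prob_densities \<kappa>"
    and posterior: "AE \<theta> in \<kappa>. pooled_posterior n w p y q \<theta> = Z * \<pi> \<theta>"
begin

abbreviation "loss \<equiv> neg_log_likelihood p y"

lemma loss_measurable [measurable]: "loss \<in> borel_measurable \<kappa>"
  unfolding neg_log_likelihood_def [abs_def] by measurable

lemma q_measurable [measurable]: "j \<in> {1..n} \<Longrightarrow> q j \<in> borel_measurable \<kappa>"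
  using q prob_densitiesD(1) by blast

lemma pairing_finiteD:
  assumes s: "\<sigma> \<in> prob_densities \<kappa>" and fin: "\<bar>pairing \<kappa> loss \<sigma>\<bar> \<noteq> \<infinity>"
  shows "integrable \<kappa> (\<lambda>\<theta>. - (\<sigma> \<theta> * ln (p \<theta> y)))"
    and "AE \<theta> in \<kappa>. 0 < \<sigma> \<theta> \<longrightarrow> 0 < p \<theta> y"
    and "pairing \<kappa> loss \<sigma> = ereal (\<integral>\<theta>. - (\<sigma> \<theta> * ln (p \<theta> y)) \<partial>\<kappa>)"
proof -
  note [measurable] = prob_densitiesD(1)[OF s]
  have "(\<lambda>\<theta>. loss \<theta> * ereal (\<sigma> \<theta>)) \<in> borel_measurable \<kappa>"
    by measurable
  then obtain h where h: "integrable \<kappa> h"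
    and eq: "AE \<theta> in \<kappa>. loss \<theta> * ereal (\<sigma> \<theta>) = ereal (h \<theta>)"
    using fin ext_integral_finiteE unfolding pairing_def by metis
  have *: "AE \<theta> in \<kappa>. (0 < \<sigma> \<theta> \<longrightarrow> 0 < p \<theta> y) \<and> h \<theta> = - (\<sigma> \<theta> * ln (p \<theta> y))"
    using eq AE_space
  proof eventually_elim
    case (elim \<theta>)
    note nn = prob_densitiesD(2)[OF s elim(2)] p_nonneg[OF elim(2)]
    show ?case
      using elim(1) nn(2) unfolding loss_integrand_eq[where p = p, OF nn] by (auto split: if_splits)
  qed
  then show "AE \<theta> in \<kappa>. 0 < \<sigma> \<theta> \<longrightarrow> 0 < p \<theta> y" by auto
  show int: "integrable \<kappa> (\<lambda>\<theta>. - (\<sigma> \<theta> * ln (p \<theta> y)))"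
    by (rule integrable_cong_AE_imp[OF h]) (use * in auto)
  show "pairing \<kappa> loss \<sigma> = ereal (\<integral>\<theta>. - (\<sigma> \<theta> * ln (p \<theta> y)) \<partial>\<kappa>)"
    unfolding pairing_def by (rule ext_integral_ereal[OF int]) (use eq * in eventually_elim, simp)
qed

text \<open>The real-valued counterpart of the integrand of the regularizer; it represents that
  integrand only where \<open>0 < \<sigma> \<theta>\<close> implies \<open>0 < q j \<theta>\<close>
  for every agent of nonzero weight.\<close>

abbreviation "cross \<sigma> \<theta> \<equiv> (\<Sum>j\<in>{1..n}. w j * (\<sigma> \<theta> * ln (\<sigma> \<theta> / q j \<theta>)))"

text \<open>Finiteness is asked only for nonzero weights: a summand of weight 0 contributes 0 to
  both sides, even if its divergence is infinite.\<close>

lemma regularizer_eq_integral: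
  assumes s: "\<sigma> \<in> prob_densities \<kappa>"
    and fin: "\<forall>j\<in>{1..n}. w j \<noteq> 0 \<longrightarrow> KL_densities \<kappa> \<sigma> (q j) \<noteq> \<infinity>"
  shows "integrable \<kappa> (cross \<sigma>)"
    and "dsmd_regularizer \<kappa> n w q \<sigma> = ereal (integral\<^sup>L \<kappa> (cross \<sigma>))"
    and "AE \<theta> in \<kappa>. \<forall>j\<in>{1..n}. 0 < \<sigma> \<theta> \<longrightarrow> w j \<noteq> 0 \<longrightarrow> 0 < q j \<theta>"
proof -
  have int: "integrable \<kappa> (\<lambda>\<theta>. w j * (\<sigma> \<theta> * ln (\<sigma> \<theta> / q j \<theta>)))" if "j \<in> {1..n}" for j
    using KL_densities_finiteD(1)[OF s q[OF that]] fin that by (cases "w j = 0") auto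
  then show "integrable \<kappa> (cross \<sigma>)"
    by (rule Bochner_Integration.integrable_sum)
  have "ereal (w j) * KL_densities \<kappa> \<sigma> (q j) = ereal (\<integral>\<theta>. w j * (\<sigma> \<theta> * ln (\<sigma> \<theta> / q j \<theta>)) \<partial>\<kappa>)"
    if j: "j \<in> {1..n}" for j
  proof (cases "w j = 0")
    case False
    then have "KL_densities \<kappa> \<sigma> (q j) \<noteq> \<infinity>" using fin j by blast
    then show ?thesis
      using KL_densities_eq_integral[OF s q[OF j] KL_densities_finiteD[OF s q[OF j]]] by simp
  qed (simp add: zero_ereal_def[symmetric])
  then show "dsmd_regularizer \<kappa> n w q \<sigma> = ereal (integral\<^sup>L \<kappa> (cross \<sigma>))"
    unfolding dsmd_regularizer_def using int by (simp add: Bochner_Integration.integral_sum)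
  show "AE \<theta> in \<kappa>. \<forall>j\<in>{1..n}. 0 < \<sigma> \<theta> \<longrightarrow> w j \<noteq> 0 \<longrightarrow> 0 < q j \<theta>"
  proof (intro AE_finite_allI)
    show "AE \<theta> in \<kappa>. 0 < \<sigma> \<theta> \<longrightarrow> w j \<noteq> 0 \<longrightarrow> 0 < q j \<theta>" if j: "j \<in> {1..n}" for j
    proof (cases "w j = 0")
      case False
      then show ?thesis
        using KL_densities_finiteD(2)[OF s q[OF j]] fin j by auto
    qed auto
  qed simp
qed

text \<open>A nonzero weight is positive, so an infinite divergence would give a summand
  \<infinity>, and in \<open>ereal\<close> one such summand makes the whole sum \<infinity>.\<close>

lemma regularizer_finiteD:
  assumes "dsmd_regularizer \<kappa> n w q \<sigma> \<noteq> \<infinity>"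
  shows "\<forall>j\<in>{1..n}. w j \<noteq> 0 \<longrightarrow> KL_densities \<kappa> \<sigma> (q j) \<noteq> \<infinity>"
proof (intro ballI impI)
  fix j assume "j \<in> {1..n}" "w j \<noteq> 0"
  with assms w_nonneg[of j] show "KL_densities \<kappa> \<sigma> (q j) \<noteq> \<infinity>"
    by (auto simp: dsmd_regularizer_def sum_Pinfty)
qed

lemma pairing_not_MInf:
  assumes s: "\<sigma> \<in> prob_densities \<kappa>" and reg: "dsmd_regularizer \<kappa> n w q \<sigma> \<noteq> \<infinity>"
  shows "pairing \<kappa> loss \<sigma> \<noteq> - \<infinity>"
proof -
  note [measurable] = prob_densitiesD(1)[OF s]
  note R = regularizer_eq_integral[OF s regularizer_finiteD[OF reg]]
  \<comment> \<open>The minorant solves \<open>entropy_decomposition\<close> for the loss and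
    replaces \<open>\<sigma> ln (\<sigma> / \<pi>)\<close> by its lower bound
    \<open>\<sigma> - \<pi>\<close>; it is integrable because the regularizer is finite.\<close>
  have "ereal (\<integral>\<theta>. \<sigma> \<theta> - \<pi> \<theta> - \<sigma> \<theta> * ln Z - cross \<sigma> \<theta> \<partial>\<kappa>) \<le> pairing \<kappa> loss \<sigma>"
    unfolding pairing_def
  proof (rule ext_integral_ge)
    show "integrable \<kappa> (\<lambda>\<theta>. \<sigma> \<theta> - \<pi> \<theta> - \<sigma> \<theta> * ln Z - cross \<sigma> \<theta>)"
      using R(1) prob_densitiesD(3)[OF s] prob_densitiesD(3)[OF \<pi>] by auto
    show "AE \<theta> in \<kappa>. ereal (\<sigma> \<theta> - \<pi> \<theta> - \<sigma> \<theta> * ln Z - cross \<sigma> \<theta>) \<le> loss \<theta> * ereal (\<sigma> \<theta>)"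
      using R(3) posterior AE_space
    proof eventually_elim
      case (elim \<theta>)
      have nn: "0 \<le> \<sigma> \<theta>" "0 \<le> \<pi> \<theta>" "0 \<le> p \<theta> y"
        using elim s \<pi> p_nonneg by (auto dest: prob_densitiesD)
      show ?case
      \<comment> \<open>At a point of positive density and zero likelihood the loss integrand is
        \<infinity> and the bound is trivial; elsewhere the decomposition applies.\<close>
      proof (cases "0 < \<sigma> \<theta> \<and> p \<theta> y = 0")
        case False
        then have pos: "0 < \<sigma> \<theta> \<Longrightarrow> 0 < p \<theta> y" using nn by auto
        have "\<lbrakk>0 < \<sigma> \<theta>; j \<in> {1..n}; w j \<noteq> 0\<rbrakk> \<Longrightarrow> 0 < q j \<theta>" for j
          using elim by auto
        note D = entropy_decomposition[where n = n and w = w, OF Z_pos w_sum nn(1) pos this elim(2)]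
        show ?thesis
          using gibbs_pointwise(1)[OF nn(1,2) D(1)] D(2) False nn
          by (auto simp: loss_integrand_eq)
      qed (use nn in \<open>auto simp: loss_integrand_eq\<close>)
    qed
  qed measurable
  then show ?thesis by auto
qed

text \<open>Neither summand is infinite here, so the pointwise decomposition can be integrated term
  by term; \<open>\<sigma> ln Z\<close> integrates to \<open>ln Z\<close> as \<open>\<sigma>\<close>
  has total mass 1.\<close>

lemma objective_finiteD:
  assumes s: "\<sigma> \<in> prob_densities \<kappa>" and reg: "dsmd_regularizer \<kappa> n w q \<sigma> \<noteq> \<infinity>"
    and pair: "pairing \<kappa> loss \<sigma> \<noteq> \<infinity>"
  defines "D \<equiv> \<lambda>\<theta>. \<sigma> \<theta> * ln (\<sigma> \<theta> / \<pi> \<theta>)"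
  shows "integrable \<kappa> D" and "dsmd_objective \<kappa> n w loss q \<sigma> = ereal (integral\<^sup>L \<kappa> D - ln Z)"
    and "AE \<theta> in \<kappa>. 0 < \<sigma> \<theta> \<longrightarrow> 0 < \<pi> \<theta>"
proof -
  note [measurable] = prob_densitiesD(1)[OF s] prob_densitiesD(1)[OF \<pi>]
  note R = regularizer_eq_integral[OF s regularizer_finiteD[OF reg]]
  have "\<bar>pairing \<kappa> loss \<sigma>\<bar> \<noteq> \<infinity>"
    using pairing_not_MInf[OF s reg] pair by auto
  note P = pairing_finiteD[OF s this]
  have *: "AE \<theta> in \<kappa>. (0 < \<sigma> \<theta> \<longrightarrow> 0 < \<pi> \<theta>) \<and>
      - (\<sigma> \<theta> * ln (p \<theta> y)) + cross \<sigma> \<theta> + \<sigma> \<theta> * ln Z = D \<theta>"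
    using R(3) P(2) posterior AE_space
  proof eventually_elim
    case (elim \<theta>)
    have "0 \<le> \<sigma> \<theta>"
      using elim s by (auto dest: prob_densitiesD)
    then show ?case
      using entropy_decomposition[where n = n and w = w and s = "\<sigma> \<theta>" and p = p and \<theta> = \<theta>
          and y = y and q = q and t = "\<pi> \<theta>" and Z = Z] Z_pos w_sum elim
      by (auto simp: D_def)
  qed
  then show "AE \<theta> in \<kappa>. 0 < \<sigma> \<theta> \<longrightarrow> 0 < \<pi> \<theta>" by auto
  have int: "integrable \<kappa> (\<lambda>\<theta>. - (\<sigma> \<theta> * ln (p \<theta> y)) + cross \<sigma> \<theta> + \<sigma> \<theta> * ln Z)"
    by (intro Bochner_Integration.integrable_add P(1) R(1) integrable_mult_left prob_densitiesD(3)[OF s])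
  have D_measurable: "D \<in> borel_measurable \<kappa>"
    unfolding D_def by measurable
  show "integrable \<kappa> D"
    by (rule integrable_cong_AE_imp[OF int D_measurable]) (use * in auto)
  have "integral\<^sup>L \<kappa> D = (\<integral>\<theta>. - (\<sigma> \<theta> * ln (p \<theta> y)) + cross \<sigma> \<theta> + \<sigma> \<theta> * ln Z \<partial>\<kappa>)"
    by (rule integral_cong_AE[OF D_measurable borel_measurable_integrable[OF int]]) (use * in auto)
  also have "\<dots> = (\<integral>\<theta>. - (\<sigma> \<theta> * ln (p \<theta> y)) \<partial>\<kappa>) + integral\<^sup>L \<kappa> (cross \<sigma>) + ln Z"
    using P(1) R(1) prob_densitiesD(3,4)[OF s]
    by (subst Bochner_Integration.integral_add | simp)+
  finally show "dsmd_objective \<kappa> n w loss q \<sigma> = ereal (integral\<^sup>L \<kappa> D - ln Z)"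
    using P(3) R(2) by (simp add: dsmd_objective_def)
qed

lemma objective_ge:
  assumes s: "\<sigma> \<in> prob_densities \<kappa>"
  shows "ereal (- ln Z) \<le> dsmd_objective \<kappa> n w loss q \<sigma>"
    and "dsmd_objective \<kappa> n w loss q \<sigma> \<le> ereal (- ln Z) \<Longrightarrow> AE \<theta> in \<kappa>. \<pi> \<theta> = \<sigma> \<theta>"
proof -
  \<comment> \<open>Subtracting \<open>\<sigma> - \<pi>\<close>, whose integral is 0, leaves the
    integral of the divergence integrand unchanged and makes it pointwise nonnegative, so that a
    vanishing integral yields \<open>G = 0\<close> almost everywhere.\<close>
  define G where "G \<theta> = \<sigma> \<theta> * ln (\<sigma> \<theta> / \<pi> \<theta>) - (\<sigma> \<theta> - \<pi> \<theta>)" for \<theta>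
  have main: "integrable \<kappa> G \<and> dsmd_objective \<kappa> n w loss q \<sigma> = ereal (integral\<^sup>L \<kappa> G - ln Z) \<and>
      (AE \<theta> in \<kappa>. 0 \<le> G \<theta> \<and> (G \<theta> = 0 \<longrightarrow> \<pi> \<theta> = \<sigma> \<theta>))"
    if "dsmd_objective \<kappa> n w loss q \<sigma> \<noteq> \<infinity>"
  proof -
    \<comment> \<open>In \<open>ereal\<close> a sum with one summand \<infinity> is \<infinity>,
      even if the other is -\<infinity>.\<close>
    have "dsmd_regularizer \<kappa> n w q \<sigma> \<noteq> \<infinity>" "pairing \<kappa> loss \<sigma> \<noteq> \<infinity>"
      using that by (auto simp: dsmd_objective_def)
    note D = objective_finiteD[OF s this]
    have "AE \<theta> in \<kappa>. 0 \<le> G \<theta> \<and> (G \<theta> = 0 \<longrightarrow> \<pi> \<theta> = \<sigma> \<theta>)"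
      using D(3) AE_space
    proof eventually_elim
      case (elim \<theta>)
      then have "0 \<le> \<sigma> \<theta>" "0 \<le> \<pi> \<theta>"
        using s \<pi> by (auto dest: prob_densitiesD)
      then show ?case
        using gibbs_pointwise[of "\<sigma> \<theta>" "\<pi> \<theta>"] elim by (auto simp: G_def)
    qed
    then show ?thesis
      using D prob_densitiesD(3,4)[OF s] prob_densitiesD(3,4)[OF \<pi>] by (simp add: G_def [abs_def])
  qed
  show "ereal (- ln Z) \<le> dsmd_objective \<kappa> n w loss q \<sigma>"
  proof (cases "dsmd_objective \<kappa> n w loss q \<sigma> = \<infinity>")
    case False
    have "0 \<le> integral\<^sup>L \<kappa> G"
      by (rule integral_nonneg_AE) (use main[OF False] in auto)
    then show ?thesis using main[OF False] by simp
  qed simp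
  show "AE \<theta> in \<kappa>. \<pi> \<theta> = \<sigma> \<theta>" if le: "dsmd_objective \<kappa> n w loss q \<sigma> \<le> ereal (- ln Z)"
  proof -
    have "dsmd_objective \<kappa> n w loss q \<sigma> \<noteq> \<infinity>" using le by auto
    note m = main[OF this]
    have nn: "AE \<theta> in \<kappa>. 0 \<le> G \<theta>" using m by auto
    then have "integral\<^sup>L \<kappa> G = 0"
      using m le integral_nonneg_AE[OF nn] by simp
    then have "AE \<theta> in \<kappa>. G \<theta> = 0"
      using m nn integral_nonneg_eq_0_iff_AE by blast
    then show ?thesis using m by auto
  qed
qed

section \<open>The objective at the posterior\<close>

text \<open>A nonzero product has no zero factor. Since \<open>weight_power\<close> is 1 for weight
  0, only agents of nonzero weight are constrained.\<close>

lemma posterior_pos: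
  "AE \<theta> in \<kappa>. 0 < \<pi> \<theta> \<longrightarrow> 0 < p \<theta> y \<and> (\<forall>j\<in>{1..n}. w j \<noteq> 0 \<longrightarrow> 0 < q j \<theta>)"
  using posterior AE_space
proof eventually_elim
  case (elim \<theta>)
  show ?case
  proof
    assume "0 < \<pi> \<theta>"
    then have "pooled_posterior n w p y q \<theta> \<noteq> 0" using elim Z_pos by simp
    then have "p \<theta> y \<noteq> 0" "\<forall>j\<in>{1..n}. weight_power (q j \<theta>) (w j) \<noteq> 0"
      by (auto simp: pooled_posterior_def)
    moreover have "0 \<le> p \<theta> y" "\<forall>j\<in>{1..n}. 0 \<le> q j \<theta>"
      using elim p_nonneg prob_densitiesD(2)[OF q] by auto
    ultimately show "0 < p \<theta> y \<and> (\<forall>j\<in>{1..n}. w j \<noteq> 0 \<longrightarrow> 0 < q j \<theta>)"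
      by (auto simp: weight_power_def less_le)
  qed
qed

text \<open>The decomposition with \<open>s = t = \<pi> \<theta>\<close>: the term
  \<open>s ln (s / t)\<close> drops out, which expresses the loss by
  \<open>cross \<pi>\<close>.\<close>

lemma loss_posterior:
  "AE \<theta> in \<kappa>. loss \<theta> * ereal (\<pi> \<theta>) = ereal (- (\<pi> \<theta> * ln Z) - cross \<pi> \<theta>) \<and>
     - (\<pi> \<theta> * ln (p \<theta> y)) = - (\<pi> \<theta> * ln Z) - cross \<pi> \<theta>"
  using posterior_pos posterior AE_space
proof eventually_elim
  case (elim \<theta>)
  have nn: "0 \<le> \<pi> \<theta>" "0 \<le> p \<theta> y"
    using elim \<pi> p_nonneg by (auto dest: prob_densitiesD)
  have "- (\<pi> \<theta> * ln (p \<theta> y)) + cross \<pi> \<theta> = \<pi> \<theta> * ln (\<pi> \<theta> / \<pi> \<theta>) - \<pi> \<theta> * ln Z"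
    using elim by (intro entropy_decomposition(2)[OF Z_pos w_sum nn(1)]) auto
  also have "\<pi> \<theta> * ln (\<pi> \<theta> / \<pi> \<theta>) = 0"
    by (cases "\<pi> \<theta> = 0") auto
  finally show ?case
    using nn elim by (auto simp: loss_integrand_eq)
qed

lemma KL_term_ge:
  "AE \<theta> in \<kappa>. \<forall>j\<in>{1..n}. w j * (\<pi> \<theta> - q j \<theta>) \<le> w j * (\<pi> \<theta> * ln (\<pi> \<theta> / q j \<theta>))"
  using posterior_pos AE_space
proof eventually_elim
  case (elim \<theta>)
  show ?case
  proof
    fix j assume j: "j \<in> {1..n}"
    have "0 \<le> \<pi> \<theta>" "0 \<le> q j \<theta>"
      using elim j \<pi> q by (auto dest: prob_densitiesD)
    then show "w j * (\<pi> \<theta> - q j \<theta>) \<le> w j * (\<pi> \<theta> * ln (\<pi> \<theta> / q j \<theta>))"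
      using elim j w_nonneg[OF j] gibbs_pointwise(1)[of "\<pi> \<theta>" "q j \<theta>"]
      by (cases "w j = 0") (auto intro: mult_left_mono)
  qed
qed

lemma pairing_posterior_not_PInf: "pairing \<kappa> loss \<pi> \<noteq> \<infinity>"
  unfolding pairing_def
proof (rule ext_integral_bounded_above)
  \<comment> \<open>The majorant comes from \<open>loss_posterior\<close> by replacing each term of
    \<open>cross \<pi>\<close> with its lower bound from \<open>KL_term_ge\<close>.\<close>
  show "integrable \<kappa> (\<lambda>\<theta>. - (\<pi> \<theta> * ln Z) - (\<Sum>j\<in>{1..n}. w j * (\<pi> \<theta> - q j \<theta>)))"
    by (intro Bochner_Integration.integrable_diff Bochner_Integration.integrable_minus
        Bochner_Integration.integrable_sum integrable_mult_left integrable_mult_right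
        prob_densitiesD(3)[OF \<pi>] prob_densitiesD(3)[OF q])
  show "AE \<theta> in \<kappa>. loss \<theta> * ereal (\<pi> \<theta>)
      \<le> ereal (- (\<pi> \<theta> * ln Z) - (\<Sum>j\<in>{1..n}. w j * (\<pi> \<theta> - q j \<theta>)))"
    using loss_posterior KL_term_ge
  proof eventually_elim
    case (elim \<theta>)
    have "(\<Sum>j\<in>{1..n}. w j * (\<pi> \<theta> - q j \<theta>)) \<le> cross \<pi> \<theta>"
      using elim by (intro sum_mono) auto
    then show ?case using elim by simp
  qed
qed

text \<open>All but one of the terms of \<^term>\<open>cross \<pi>\<close> are bounded below by integrable functions, so
  the integrability of the loss bounds the remaining one from above.\<close>

lemma regularizer_posterior_finite:
  assumes fin: "\<bar>pairing \<kappa> loss \<pi>\<bar> \<noteq> \<infinity>"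
  shows "dsmd_regularizer \<kappa> n w q \<pi> \<noteq> \<infinity>"
proof -
  note [measurable] = prob_densitiesD(1)[OF \<pi>]
  note P = pairing_finiteD(1)[OF \<pi> fin]
  have KL: "KL_densities \<kappa> \<pi> (q j) \<noteq> \<infinity>" if j: "j \<in> {1..n}" and wj: "w j \<noteq> 0" for j
  proof -
    \<comment> \<open>\<open>k\<close> is the term of agent \<open>j\<close> and \<open>l\<close>
      its Gibbs minorant. Solving \<open>loss_posterior\<close> for \<open>k\<close> and bounding
      the other terms from below gives the majorant \<open>u\<close>, integrable because the loss
      is.\<close>
    define k where "k \<theta> = w j * (\<pi> \<theta> * ln (\<pi> \<theta> / q j \<theta>))" for \<theta>
    define l where "l \<theta> = w j * (\<pi> \<theta> - q j \<theta>)" for \<theta>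
    define u where "u \<theta> = - (\<pi> \<theta> * ln Z) - (- (\<pi> \<theta> * ln (p \<theta> y)))
        - (\<Sum>i\<in>{1..n} - {j}. w i * (\<pi> \<theta> - q i \<theta>))" for \<theta>
    note [measurable] = q_measurable[OF j]
    have l: "integrable \<kappa> l"
      unfolding l_def
      by (intro integrable_mult_right Bochner_Integration.integrable_diff
          prob_densitiesD(3)[OF \<pi>] prob_densitiesD(3)[OF q] j)
    have u: "integrable \<kappa> u"
      unfolding u_def
      by (intro Bochner_Integration.integrable_diff Bochner_Integration.integrable_minus
          Bochner_Integration.integrable_sum integrable_mult_left integrable_mult_right
          prob_densitiesD(3)[OF \<pi>] prob_densitiesD(3)[OF q] P) auto
    have "AE \<theta> in \<kappa>. norm (k \<theta>) \<le> norm (\<bar>l \<theta>\<bar> + \<bar>u \<theta>\<bar>)"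
      using loss_posterior KL_term_ge
    proof eventually_elim
      case (elim \<theta>)
      have "cross \<pi> \<theta> = k \<theta> + (\<Sum>i\<in>{1..n} - {j}. w i * (\<pi> \<theta> * ln (\<pi> \<theta> / q i \<theta>)))"
        unfolding k_def by (rule sum.remove) (use j in auto)
      moreover have "(\<Sum>i\<in>{1..n} - {j}. w i * (\<pi> \<theta> - q i \<theta>))
          \<le> (\<Sum>i\<in>{1..n} - {j}. w i * (\<pi> \<theta> * ln (\<pi> \<theta> / q i \<theta>)))"
        using elim by (intro sum_mono) auto
      ultimately have "k \<theta> \<le> u \<theta>"
        using elim by (simp add: u_def)
      moreover have "l \<theta> \<le> k \<theta>"
        using elim j by (simp add: k_def l_def)
      ultimately show ?case by auto
    qed
    then have "integrable \<kappa> k"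
      by (rule Bochner_Integration.integrable_bound[rotated 2])
         (use l u in \<open>auto simp: k_def\<close>)
    then have "integrable \<kappa> (\<lambda>\<theta>. \<pi> \<theta> * ln (\<pi> \<theta> / q j \<theta>))"
      using wj by (simp add: k_def [abs_def])
    moreover have "AE \<theta> in \<kappa>. 0 < \<pi> \<theta> \<longrightarrow> 0 < q j \<theta>"
      using posterior_pos by eventually_elim (use j wj in auto)
    ultimately show ?thesis
      using KL_densities_eq_integral[OF \<pi> q[OF j]] by simp
  qed
  show ?thesis
    using regularizer_eq_integral(2)[OF \<pi>] KL by simp
qed

lemma objective_posterior:
  assumes "dsmd_objective_exists \<kappa> n w loss q \<pi>"
  shows "dsmd_objective \<kappa> n w loss q \<pi> = ereal (- ln Z)"
proof -
  \<comment> \<open>If the pairing were -\<infinity>, then \<open>pairing_not_MInf\<close> would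
    force the regularizer to be \<infinity>, the form \<infinity> - \<infinity> that the existence
    assumption forbids.\<close>
  have "\<bar>pairing \<kappa> loss \<pi>\<bar> \<noteq> \<infinity>"
    using assms pairing_not_MInf[OF \<pi>] pairing_posterior_not_PInf
    by (auto simp: dsmd_objective_exists_def)
  note R = regularizer_posterior_finite[OF this]
  have "(\<lambda>\<theta>. \<pi> \<theta> * ln (\<pi> \<theta> / \<pi> \<theta>)) = (\<lambda>\<theta>. 0)"
    by (rule ext) simp
  then show ?thesis
    using objective_finiteD(2)[OF \<pi> R pairing_posterior_not_PInf] by (simp del: divide_self_if)
qed

text \<open>The objective at \<open>\<pi>\<close> equals the lower bound \<open>- ln Z\<close>, so
  \<open>\<pi>\<close> is a minimizer, and any other minimizer attains the bound and falls under the
  equality case of \<open>objective_ge\<close>.\<close>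

lemma is_dsmd_update_posterior:
  assumes "dsmd_objective_exists \<kappa> n w loss q \<pi>"
  shows "is_dsmd_update \<kappa> n w loss q \<pi>"
    and "is_dsmd_update \<kappa> n w loss q \<sigma> \<Longrightarrow> AE \<theta> in \<kappa>. \<pi> \<theta> = \<sigma> \<theta>"
proof -
  note O = objective_posterior[OF assms]
  show "is_dsmd_update \<kappa> n w loss q \<pi>"
    using O \<pi> objective_ge(1) by (auto simp: is_dsmd_update_def is_arg_min_def not_less)
  show "AE \<theta> in \<kappa>. \<pi> \<theta> = \<sigma> \<theta>" if "is_dsmd_update \<kappa> n w loss q \<sigma>"
    using that O \<pi> by (intro objective_ge(2)) (auto simp: is_dsmd_update_def is_arg_min_def not_less)
qed

end

section \<open>From the normalized measure to its densities\<close>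

lemma proportional_to_density:
  assumes g [measurable]: "g \<in> borel_measurable \<kappa>" and nn: "\<And>\<theta>. \<theta> \<in> space \<kappa> \<Longrightarrow> 0 \<le> g \<theta>"
    and proportional: "proportional_to \<kappa> N g"
  obtains Z :: real where "0 < Z" "prob_density_of \<kappa> N (\<lambda>\<theta>. g \<theta> / Z)"
proof -
  \<comment> \<open>A total mass other than 0 and \<infinity> is a positive real, so dividing by it
    can be done in the reals.\<close>
  obtain Z where Z: "0 < Z" "(\<integral>\<^sup>+ \<theta>. ennreal (g \<theta>) \<partial>\<kappa>) = ennreal Z"
    using proportional unfolding proportional_to_def Let_def
    by (metis ennreal_cases infinity_ennreal_def ennreal_0 less_le)
  have sets: "sets N = sets \<kappa>" and
    N: "\<And>B. B \<in> sets \<kappa> \<Longrightarrow> emeasure N B = (\<integral>\<^sup>+ \<theta>\<in>B. ennreal (g \<theta>) \<partial>\<kappa>) / ennreal Z"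
    using proportional Z unfolding proportional_to_def Let_def by auto
  have eq: "ennreal (g \<theta> / Z) = ennreal (g \<theta>) / ennreal Z" if "\<theta> \<in> space \<kappa>" for \<theta>
    using divide_ennreal[OF nn[OF that] Z(1)] by simp
  have "(\<integral>\<^sup>+ \<theta>. ennreal (g \<theta> / Z) \<partial>\<kappa>) = (\<integral>\<^sup>+ \<theta>. ennreal (g \<theta>) / ennreal Z \<partial>\<kappa>)"
    by (rule nn_integral_cong) (rule eq)
  also have "\<dots> = 1"
    using Z by (simp add: nn_integral_divide divide_ennreal)
  finally have 1: "(\<lambda>\<theta>. g \<theta> / Z) \<in> prob_densities \<kappa>"
    using nn Z by (auto simp: prob_densities_def)
  have "N = density \<kappa> (\<lambda>\<theta>. ennreal (g \<theta> / Z))"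
  proof (rule measure_eqI)
    fix B assume "B \<in> sets N"
    then have [measurable]: "B \<in> sets \<kappa>" using sets by simp
    have "emeasure (density \<kappa> (\<lambda>\<theta>. ennreal (g \<theta> / Z))) B
        = (\<integral>\<^sup>+ \<theta>. ennreal (g \<theta> / Z) * indicator B \<theta> \<partial>\<kappa>)"
      by (rule emeasure_density) measurable
    also have "\<dots> = (\<integral>\<^sup>+ \<theta>. (ennreal (g \<theta>) * indicator B \<theta>) / ennreal Z \<partial>\<kappa>)"
      by (rule nn_integral_cong) (auto simp: eq indicator_def)
    also have "\<dots> = emeasure N B"
      by (simp add: nn_integral_divide N)
    finally show "emeasure N B = emeasure (density \<kappa> (\<lambda>\<theta>. ennreal (g \<theta> / Z))) B" by simp
  qed (use sets in simp)
  with 1 Z show thesis by (intro that[of Z]) (auto simp: prob_density_of_def)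
qed

text \<open>Equal measures of finite mass have almost everywhere equal \<open>ennreal\<close>
  densities, and nonnegativity carries the equality over to the reals.\<close>

lemma prob_density_of_unique:
  assumes "prob_density_of M N f" "prob_density_of M N g"
  shows "AE x in M. f x = g x"
proof -
  have "AE x in M. ennreal (f x) = ennreal (g x)"
    using assms by (subst finite_density_unique[symmetric])
      (auto simp: prob_density_of_def prob_densities_def)
  then show ?thesis
    using AE_space
    by eventually_elim (use assms in \<open>auto simp: prob_density_of_def prob_densities_def\<close>)
qed

theorem proposition1:
  fixes n :: nat
    and E :: "(nat \<times> nat) set"
    and a :: "nat \<Rightarrow> nat \<Rightarrow> real"
    and \<kappa> :: "'t measure"
    and L P :: "nat \<Rightarrow> 'x measure"
    and P\<^sub>\<theta> :: "nat \<Rightarrow> 't \<Rightarrow> 'x measure"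
    and p :: "nat \<Rightarrow> 't \<Rightarrow> 'x \<Rightarrow> real"
    and x :: "nat \<Rightarrow> nat \<Rightarrow> 'x"
    and \<mu> :: "nat \<Rightarrow> nat \<Rightarrow> 't measure"
    and d :: "nat \<Rightarrow> 't \<Rightarrow> real"
    and i k :: nat
  assumes model: "cooperative_inference n E a \<kappa> L P P\<^sub>\<theta> p"
    and agent: "i \<in> {1..n}"
    and observation: "x i (Suc k) \<in> space (L i)"
    and beliefs: "\<And>j. j \<in> {1..n} \<Longrightarrow> prob_density_of \<kappa> (\<mu> k j) (d j)"
    and protocol:
      "proportional_to \<kappa> (\<mu> (Suc k) i) (pooled_posterior n (a i) (p i) (x i (Suc k)) d)"
    and objective_exists:
      "\<And>\<pi>. prob_density_of \<kappa> (\<mu> (Suc k) i) \<pi> \<Longrightarrow>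
         dsmd_objective_exists \<kappa> n (a i) (neg_log_likelihood (p i) (x i (Suc k))) d \<pi>"
  shows "prob_space (\<mu> (Suc k) i) \<and>
         (\<exists>\<pi>. prob_density_of \<kappa> (\<mu> (Suc k) i) \<pi>) \<and>
         (\<forall>\<pi>. prob_density_of \<kappa> (\<mu> (Suc k) i) \<pi> \<longrightarrow>
            is_dsmd_update \<kappa> n (a i) (neg_log_likelihood (p i) (x i (Suc k))) d \<pi> \<and>
            (\<forall>\<sigma>. is_dsmd_update \<kappa> n (a i) (neg_log_likelihood (p i) (x i (Suc k))) d \<sigma> \<longrightarrow>
                 (AE \<theta> in \<kappa>. \<pi> \<theta> = \<sigma> \<theta>)))"
proof -
  interpret cooperative_inference n E a \<kappa> L P P\<^sub>\<theta> p by (rule model)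
  let ?y = "x i (Suc k)"
  let ?g = "pooled_posterior n (a i) (p i) ?y d"
  let ?N = "\<mu> (Suc k) i"
  have w_nonneg: "0 \<le> a i j" if "j \<in> {1..n}" for j
    using weight_pos[OF agent that] weight_zero[OF agent that] by (cases "(i, j) \<in> E \<or> j = i") auto
  have p_nonneg: "0 \<le> p i \<theta> ?y" if "\<theta> \<in> space \<kappa>" for \<theta>
    using model_density[OF agent that] observation
    by (auto simp: prob_density_of_def prob_densities_def)
  have p_measurable [measurable]: "(\<lambda>\<theta>. p i \<theta> ?y) \<in> borel_measurable \<kappa>"
    by (rule measurable_parameter[OF agent observation])
  have d: "d j \<in> prob_densities \<kappa>" if "j \<in> {1..n}" for j
    using beliefs[OF that] by (simp add: prob_density_of_def)
  have "(\<lambda>\<theta>. weight_power (d j \<theta>) (a i j)) \<in> borel_measurable \<kappa>" if "j \<in> {1..n}" for j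
    using prob_densitiesD(1)[OF d[OF that]] by (cases "a i j = 0") (auto simp: weight_power_def)
  then have g: "?g \<in> borel_measurable \<kappa>"
    unfolding pooled_posterior_def [abs_def] by (intro borel_measurable_times borel_measurable_prod) auto
  have g_nonneg: "0 \<le> ?g \<theta>" if "\<theta> \<in> space \<kappa>" for \<theta>
    using p_nonneg[OF that] by (simp add: pooled_posterior_def prod_nonneg weight_power_nonneg)
  obtain Z where Z: "0 < Z" and dens: "prob_density_of \<kappa> ?N (\<lambda>\<theta>. ?g \<theta> / Z)"
    using proportional_to_density[OF g g_nonneg protocol] by blast
  have upd: "is_dsmd_update \<kappa> n (a i) (neg_log_likelihood (p i) ?y) d \<pi> \<and>
      (\<forall>\<sigma>. is_dsmd_update \<kappa> n (a i) (neg_log_likelihood (p i) ?y) d \<sigma> \<longrightarrow> (AE \<theta> in \<kappa>. \<pi> \<theta> = \<sigma> \<theta>))"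
    if dens_\<pi>: "prob_density_of \<kappa> ?N \<pi>" for \<pi>
  proof -
    \<comment> \<open>An arbitrary version \<open>\<pi>\<close> agrees almost everywhere with
      \<open>?g / Z\<close>, so it can itself take the place of the posterior in
      \<open>pooled_update\<close>.\<close>
    have "AE \<theta> in \<kappa>. ?g \<theta> = Z * \<pi> \<theta>"
      using prob_density_of_unique[OF dens_\<pi> dens] by eventually_elim (use Z in simp)
    then interpret pooled_update \<kappa> n "a i" "p i" ?y d Z \<pi>
      using dens_\<pi> weight_sum[OF agent] by unfold_locales
        (auto simp: w_nonneg p_nonneg d Z prob_density_of_def)
    show ?thesis
      using is_dsmd_update_posterior[OF objective_exists[OF dens_\<pi>]] by blast
  qed
  show ?thesis
    using prob_space_prob_density_of[OF dens] dens upd by blast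
qed

end
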